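(* Let $\Gamma_1 = \mathrm{Homeo}_c(\mathbb{R})$, and let $\Gamma_2$ be a group with commuting conjugates that does not have commuting $\mathbb{Z}$-conjugates. Then $\Gamma_1 \times \Gamma_2$ has commuting conjugates but does not have commuting cyclic conjugates.
   Context: $\mathrm{Homeo}_c(\mathbb{R})$ denotes the group (viewed as a discrete group) of compactly supported homeomorphisms of $\mathbb{R}$. We write ${}^t H = tHt^{-1}$. A group $\Gamma$ has *commuting conjugates* if for every finitely generated subgroup $H \leq \Gamma$ there exists $t \in \Gamma$ such that $[H, {}^t H] = 1$. $\Gamma$ has *commuting $\mathbb{Z}$-conjugates* if for every finitely generated subgroup $H \leq \Gamma$ there exists $t \in \Gamma$ such that $[H, {}^{t^p} H] = 1$ for all integers $p \geq 1$. $\Gamma$ has *commuting cyclic conjugates* if for every finitely generated subgroup $H \leq \Gamma$ there exist $t \in \Gamma$ and $n \in \mathbb{Z}_{\geq 2} \cup \{\infty\}$ such that $[H, {}^{t^p} H] = 1$ for all integers $1 \leq p < n$ and $[H, t^n] = 1$, where $t^\infty$ is read as $1$. *)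

theory Defs
  imports "HOL-Analysis.Analysis" "HOL-Algebra.Generated_Groups"
begin

definition homeo_c :: "(real \<Rightarrow> real) monoid" where
  "homeo_c =
    \<lparr> carrier = {f. (\<exists>g. homeomorphism UNIV UNIV f g) \<and> compact (closure {x. f x \<noteq> x})},
      mult = (\<circ>), one = id \<rparr>"

definition fg_subgroup :: "'a set \<Rightarrow> ('a, 'b) monoid_scheme \<Rightarrow> bool" where
  "fg_subgroup H G \<longleftrightarrow> (\<exists>S. finite S \<and> S \<subseteq> carrier G \<and> H = generate G S)"

definition conj_set :: "('a, 'b) monoid_scheme \<Rightarrow> 'a \<Rightarrow> 'a set \<Rightarrow> 'a set" where
  "conj_set G t H = (\<lambda>h. t \<otimes>\<^bsub>G\<^esub> h \<otimes>\<^bsub>G\<^esub> inv\<^bsub>G\<^esub> t) ` H"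

(* derived G H from the library is commutator_subgroup G H H. *)
definition commutator_subgroup :: "('a, 'b) monoid_scheme \<Rightarrow> 'a set \<Rightarrow> 'a set \<Rightarrow> 'a set" where
  "commutator_subgroup G H K =
    generate G (\<Union>h\<in>H. \<Union>k\<in>K. {h \<otimes>\<^bsub>G\<^esub> k \<otimes>\<^bsub>G\<^esub> inv\<^bsub>G\<^esub> h \<otimes>\<^bsub>G\<^esub> inv\<^bsub>G\<^esub> k})"

definition commuting_conjugates :: "('a, 'b) monoid_scheme \<Rightarrow> bool" where
  "commuting_conjugates G \<longleftrightarrow>
    (\<forall>H. fg_subgroup H G \<longrightarrow>
      (\<exists>t\<in>carrier G. commutator_subgroup G H (conj_set G t H) = {\<one>\<^bsub>G\<^esub>}))"

definition commuting_Z_conjugates :: "('a, 'b) monoid_scheme \<Rightarrow> bool" where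
  "commuting_Z_conjugates G \<longleftrightarrow>
    (\<forall>H. fg_subgroup H G \<longrightarrow>
      (\<exists>t\<in>carrier G. \<forall>p::nat. p \<ge> 1 \<longrightarrow>
        commutator_subgroup G H (conj_set G (t [^]\<^bsub>G\<^esub> p) H) = {\<one>\<^bsub>G\<^esub>}))"

fun enat_pow :: "('a, 'b) monoid_scheme \<Rightarrow> 'a \<Rightarrow> enat \<Rightarrow> 'a" where
  "enat_pow G t (enat n) = t [^]\<^bsub>G\<^esub> n"
| "enat_pow G t \<infinity> = \<one>\<^bsub>G\<^esub>"

(* The condition [H, t^n] = 1 is about a single element, hence the singleton below. *)
definition commuting_cyclic_conjugates :: "('a, 'b) monoid_scheme \<Rightarrow> bool" where
  "commuting_cyclic_conjugates G \<longleftrightarrow>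
    (\<forall>H. fg_subgroup H G \<longrightarrow>
      (\<exists>t\<in>carrier G. \<exists>n::enat. n \<ge> 2 \<and>
        (\<forall>p::nat. 1 \<le> p \<and> enat p < n \<longrightarrow>
          commutator_subgroup G H (conj_set G (t [^]\<^bsub>G\<^esub> p) H) = {\<one>\<^bsub>G\<^esub>}) \<and>
        commutator_subgroup G H {enat_pow G t n} = {\<one>\<^bsub>G\<^esub>}))"

lemma group_homeo_c: "group homeo_c"
proof (rule groupI)
  fix f g assume "f \<in> carrier homeo_c" "g \<in> carrier homeo_c"
  then obtain f' g' where h: "homeomorphism UNIV UNIV f f'" "homeomorphism UNIV UNIV g g'"
    and c: "compact (closure {x. f x \<noteq> x})" "compact (closure {x. g x \<noteq> x})"
    by (auto simp: homeo_c_def)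
  have "{x. (f \<circ> g) x \<noteq> x} \<subseteq> {x. f x \<noteq> x} \<union> {x. g x \<noteq> x}"
    by auto
  then have "bounded {x. (f \<circ> g) x \<noteq> x}"
    using c by (meson bounded_Un bounded_subset compact_closure)
  then show "f \<otimes>\<^bsub>homeo_c\<^esub> g \<in> carrier homeo_c"
    using homeomorphism_compose[OF h(2,1)] by (auto simp: homeo_c_def)
next
  show "\<one>\<^bsub>homeo_c\<^esub> \<in> carrier homeo_c"
    using homeomorphism_ident[of "UNIV :: real set"] by (auto simp: homeo_c_def id_def)
next
  fix f assume "f \<in> carrier homeo_c"
  then obtain f' where h: "homeomorphism UNIV UNIV f f'"
    and c: "compact (closure {x. f x \<noteq> x})"
    by (auto simp: homeo_c_def)
  have inv: "f' (f x) = x" "f (f' x) = x" for x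
    using h by (auto simp: homeomorphism_def)
  have "{x. f' x \<noteq> x} = {x. f x \<noteq> x}"
    by (auto; metis inv)
  then have "f' \<in> carrier homeo_c"
    using c homeomorphism_symD[OF h] by (auto simp: homeo_c_def)
  moreover have "f' \<otimes>\<^bsub>homeo_c\<^esub> f = \<one>\<^bsub>homeo_c\<^esub>"
    using inv by (auto simp: homeo_c_def)
  ultimately show "\<exists>y\<in>carrier homeo_c. y \<otimes>\<^bsub>homeo_c\<^esub> f = \<one>\<^bsub>homeo_c\<^esub>"
    by blast
qed (auto simp: homeo_c_def)

end

theory Submission
  imports Defs
begin

text \<open>
  Some element of \<open>homeo_c\<close> moves the common bounded support of finitely many given elements off
  itself, so the first claim holds factor by factor. For the second one, recall that compactly
  supported homeomorphisms of the line are increasing, and take \<open>h\<close> with support the interval from 0 to 1 and \<open>g\<close> with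
  \<open>g 0 \<noteq> 0\<close>. If \<open>t ^ n\<close> (for finite \<open>n > 0\<close>) and \<open>t g t\<^sup>-\<^sup>1\<close> commute with \<open>h\<close>, they preserve its
  support and so fix 0; by monotonicity \<open>t\<close> fixes 0, and then so does \<open>g\<close>, a contradiction.
  Adding \<open>g\<close> and \<open>h\<close> to a finite subset of the second factor that has no commuting
  \<open>\<int>\<close>-conjugates therefore rules out finite and infinite \<open>n\<close> alike.
\<close>

section \<open>Commutation of generated subgroups\<close>

context group
begin

lemma commutator_eq_one_iff:
  assumes "h \<in> carrier G" "k \<in> carrier G"
  shows "h \<otimes> k \<otimes> inv h \<otimes> inv k = \<one> \<longleftrightarrow> h \<otimes> k = k \<otimes> h"
proof -
  have "h \<otimes> k \<otimes> inv h \<otimes> inv k = h \<otimes> k \<otimes> inv (k \<otimes> h)"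
    using assms by (simp add: inv_mult_group m_assoc)
  then show ?thesis
    using assms by (metis inv_closed inv_equality inv_inv m_closed r_inv)
qed

lemma commutator_subgroup_eq_one_iff:
  assumes "H \<subseteq> carrier G" "K \<subseteq> carrier G"
  shows "commutator_subgroup G H K = {\<one>} \<longleftrightarrow> (\<forall>h\<in>H. \<forall>k\<in>K. h \<otimes> k = k \<otimes> h)"
proof -
  let ?C = "\<Union>h\<in>H. \<Union>k\<in>K. {h \<otimes> k \<otimes> inv h \<otimes> inv k}"
  have "generate G C = {\<one>} \<longleftrightarrow> C \<subseteq> {\<one>}" for C
  proof
    assume "generate G C = {\<one>}"
    then show "C \<subseteq> {\<one>}"
      using generate.incl[of _ C G] by auto
  next
    assume "C \<subseteq> {\<one>}"
    \<comment> \<open>Both the empty set and \<open>{\<one>}\<close> generate the trivial subgroup;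
      the empty one arises when \<open>H\<close> or \<open>K\<close> is empty.\<close>
    then have "C = {} \<or> C = {\<one>}"
      by (rule subset_singletonD)
    then show "generate G C = {\<one>}"
      using generate_empty generate_one by auto
  qed
  then have "generate G ?C = {\<one>} \<longleftrightarrow> ?C \<subseteq> {\<one>}" .
  also have "\<dots> \<longleftrightarrow> (\<forall>h\<in>H. \<forall>k\<in>K. h \<otimes> k \<otimes> inv h \<otimes> inv k = \<one>)"
    by auto
  also have "\<dots> \<longleftrightarrow> (\<forall>h\<in>H. \<forall>k\<in>K. h \<otimes> k = k \<otimes> h)"
    using assms by (meson commutator_eq_one_iff subsetD)
  finally show ?thesis
    by (simp add: commutator_subgroup_def)
qed

text \<open>The elements commuting with \<open>k\<close> form a subgroup, so it suffices to test
  generators.\<close>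

lemma commute_generate:
  assumes "S \<subseteq> carrier G" "k \<in> carrier G" "\<And>s. s \<in> S \<Longrightarrow> s \<otimes> k = k \<otimes> s"
    and "h \<in> generate G S"
  shows "h \<otimes> k = k \<otimes> h"
  using assms(4)
proof (induction rule: generate.induct)
  case one
  then show ?case using assms by simp
next
  case (incl h)
  then show ?case using assms by simp
next
  case (inv h)
  then have h: "h \<in> carrier G" "h \<otimes> k = k \<otimes> h"
    using assms by auto
  have "inv h \<otimes> k = inv h \<otimes> (k \<otimes> h) \<otimes> inv h"
    using h(1) assms(2) by (simp add: m_assoc)
  also have "\<dots> = k \<otimes> inv h"
    unfolding h(2)[symmetric] using h(1) assms(2) by (simp add: m_assoc[symmetric])
  finally show ?case .
next
  case (eng h1 h2)
  then have "h1 \<in> carrier G" "h2 \<in> carrier G"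
    using generate_in_carrier[OF assms(1)] by auto
  then show ?case
    using eng assms(2) by (metis m_assoc)
qed

text \<open>Conjugating by \<open>inv t\<close> turns one equation into the other with its sides
  swapped. This moves the conjugation from \<open>k\<close> onto \<open>h\<close>, leaving
  \<open>k\<close> free for an induction of its own.\<close>

lemma commutes_conj_iff:
  assumes "t \<in> carrier G" "h \<in> carrier G" "k \<in> carrier G"
  shows "h \<otimes> (t \<otimes> k \<otimes> inv t) = t \<otimes> k \<otimes> inv t \<otimes> h
    \<longleftrightarrow> k \<otimes> (inv t \<otimes> h \<otimes> t) = inv t \<otimes> h \<otimes> t \<otimes> k"
proof -
  have "inv t \<otimes> (h \<otimes> (t \<otimes> k \<otimes> inv t)) \<otimes> t = inv t \<otimes> h \<otimes> t \<otimes> k"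
    using assms by (simp add: m_assoc)
  moreover have "inv t \<otimes> (t \<otimes> k \<otimes> inv t \<otimes> h) \<otimes> t = k \<otimes> (inv t \<otimes> h \<otimes> t)"
    using assms by (simp add: m_assoc inv_solve_left')
  moreover have "inv t \<otimes> x \<otimes> t = inv t \<otimes> y \<otimes> t \<longleftrightarrow> x = y"
    if "x \<in> carrier G" "y \<in> carrier G" for x y
    using assms(1) that by simp
  ultimately show ?thesis
    using assms by (metis inv_closed m_closed)
qed

text \<open>Two passes of \<open>commute_generate\<close> extend commutation from generators to the
  whole subgroup: first in \<open>h\<close> with \<open>k\<close> a generator, then in
  \<open>k\<close> with \<open>h\<close> arbitrary.\<close>

lemma commutator_generate_conj_eq_one_iff:
  assumes S: "S \<subseteq> carrier G" and t: "t \<in> carrier G"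
  shows "commutator_subgroup G (generate G S) (conj_set G t (generate G S)) = {\<one>} \<longleftrightarrow>
    (\<forall>h\<in>S. \<forall>k\<in>S. h \<otimes> (t \<otimes> k \<otimes> inv t) = t \<otimes> k \<otimes> inv t \<otimes> h)"
    (is "?L \<longleftrightarrow> ?R")
proof -
  note gen = generate_in_carrier[OF S]
  have "?L \<longleftrightarrow> (\<forall>h\<in>generate G S. \<forall>k\<in>generate G S.
      h \<otimes> (t \<otimes> k \<otimes> inv t) = t \<otimes> k \<otimes> inv t \<otimes> h)"
    using t gen by (subst commutator_subgroup_eq_one_iff) (auto simp: conj_set_def)
  also have "\<dots> \<longleftrightarrow> ?R"
  proof
    assume R: ?R
    have 1: "h \<otimes> (t \<otimes> k \<otimes> inv t) = t \<otimes> k \<otimes> inv t \<otimes> h"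
      if "h \<in> generate G S" "k \<in> S" for h k
    proof (rule commute_generate[OF S _ _ that(1)])
      show "t \<otimes> k \<otimes> inv t \<in> carrier G"
        using t S that(2) by blast
      show "s \<otimes> (t \<otimes> k \<otimes> inv t) = t \<otimes> k \<otimes> inv t \<otimes> s" if "s \<in> S" for s
        using R that \<open>k \<in> S\<close> by blast
    qed
    have 2: "k \<otimes> (inv t \<otimes> h \<otimes> t) = inv t \<otimes> h \<otimes> t \<otimes> k"
      if "h \<in> generate G S" "k \<in> generate G S" for h k
    proof (rule commute_generate[OF S _ _ that(2)])
      show "inv t \<otimes> h \<otimes> t \<in> carrier G"
        using t gen that by simp
      show "s \<otimes> (inv t \<otimes> h \<otimes> t) = inv t \<otimes> h \<otimes> t \<otimes> s" if s: "s \<in> S" for s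
        using 1[OF \<open>h \<in> generate G S\<close> s]
          commutes_conj_iff[OF t gen[OF \<open>h \<in> generate G S\<close>] subsetD[OF S s]] by blast
    qed
    show "\<forall>h\<in>generate G S. \<forall>k\<in>generate G S.
        h \<otimes> (t \<otimes> k \<otimes> inv t) = t \<otimes> k \<otimes> inv t \<otimes> h"
      using 2 commutes_conj_iff[OF t gen gen] by blast
  qed (blast intro: generate.incl)
  finally show ?thesis .
qed

text \<open>Quantifying over finite generating sets reduces the definition to equations between
  generators.\<close>

lemma commuting_conjugates_iff:
  "commuting_conjugates G \<longleftrightarrow> (\<forall>S. finite S \<and> S \<subseteq> carrier G \<longrightarrow>
    (\<exists>t\<in>carrier G. \<forall>h\<in>S. \<forall>k\<in>S. h \<otimes> (t \<otimes> k \<otimes> inv t) = t \<otimes> k \<otimes> inv t \<otimes> h))"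
proof -
  have "commuting_conjugates G \<longleftrightarrow> (\<forall>S. finite S \<and> S \<subseteq> carrier G \<longrightarrow>
    (\<exists>t\<in>carrier G. commutator_subgroup G (generate G S) (conj_set G t (generate G S)) = {\<one>}))"
    unfolding commuting_conjugates_def fg_subgroup_def by blast
  then show ?thesis
    by (simp add: commutator_generate_conj_eq_one_iff cong: bex_cong)
qed

lemma commuting_Z_conjugates_iff:
  "commuting_Z_conjugates G \<longleftrightarrow> (\<forall>S. finite S \<and> S \<subseteq> carrier G \<longrightarrow>
    (\<exists>t\<in>carrier G. \<forall>p::nat. p \<ge> 1 \<longrightarrow> (\<forall>h\<in>S. \<forall>k\<in>S.
      h \<otimes> (t [^] p \<otimes> k \<otimes> inv (t [^] p)) = t [^] p \<otimes> k \<otimes> inv (t [^] p) \<otimes> h)))"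
proof -
  have "commuting_Z_conjugates G \<longleftrightarrow> (\<forall>S. finite S \<and> S \<subseteq> carrier G \<longrightarrow>
    (\<exists>t\<in>carrier G. \<forall>p::nat. p \<ge> 1 \<longrightarrow>
      commutator_subgroup G (generate G S) (conj_set G (t [^] p) (generate G S)) = {\<one>}))"
    unfolding commuting_Z_conjugates_def fg_subgroup_def by blast
  then show ?thesis
    by (simp add: commutator_generate_conj_eq_one_iff cong: bex_cong)
qed

text \<open>Same passage to generators, in the form used for a refutation. For
  \<open>n = \<infinity>\<close> the last property is trivial, since \<open>enat_pow\<close> then
  yields the identity.\<close>

lemma commuting_cyclic_conjugatesD:
  assumes "commuting_cyclic_conjugates G" "finite S" "S \<subseteq> carrier G"
  obtains t n where "t \<in> carrier G" "n \<ge> 2"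
    "\<And>p h k. 1 \<le> p \<Longrightarrow> enat p < n \<Longrightarrow> h \<in> S \<Longrightarrow> k \<in> S \<Longrightarrow>
      h \<otimes> (t [^] p \<otimes> k \<otimes> inv (t [^] p)) = t [^] p \<otimes> k \<otimes> inv (t [^] p) \<otimes> h"
    "\<And>h. h \<in> S \<Longrightarrow> h \<otimes> enat_pow G t n = enat_pow G t n \<otimes> h"
proof -
  have fg: "fg_subgroup (generate G S) G"
    using assms(2,3) unfolding fg_subgroup_def by blast
  then obtain t n where t: "t \<in> carrier G" and n: "n \<ge> 2"
    and p: "\<forall>p::nat. 1 \<le> p \<and> enat p < n \<longrightarrow>
      commutator_subgroup G (generate G S) (conj_set G (t [^] p) (generate G S)) = {\<one>}"
    and e: "commutator_subgroup G (generate G S) {enat_pow G t n} = {\<one>}"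
    using assms(1)[unfolded commuting_cyclic_conjugates_def, THEN spec, THEN mp, OF fg] by blast
  have "enat_pow G t n \<in> carrier G"
    using t by (cases n) auto
  then have "\<forall>h\<in>generate G S. h \<otimes> enat_pow G t n = enat_pow G t n \<otimes> h"
    using e generate_incl[OF assms(3)] by (simp add: commutator_subgroup_eq_one_iff)
  then have *: "h \<otimes> enat_pow G t n = enat_pow G t n \<otimes> h" if "h \<in> S" for h
    using that by (blast intro: generate.incl)
  have "h \<otimes> (t [^] p \<otimes> k \<otimes> inv (t [^] p)) = t [^] p \<otimes> k \<otimes> inv (t [^] p) \<otimes> h"
    if "1 \<le> p" "enat p < n" "h \<in> S" "k \<in> S" for p h k
    using p[THEN spec, THEN mp, OF conjI[OF that(1,2)]] that(3,4) t assms(3)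
    by (simp add: commutator_generate_conj_eq_one_iff)
  then show ?thesis
    using that[OF t n] * by blast
qed

end

section \<open>Direct products\<close>

lemma pow_DirProd:
  "(x, y) [^]\<^bsub>G \<times>\<times> H\<^esub> (n::nat) = (x [^]\<^bsub>G\<^esub> n, y [^]\<^bsub>H\<^esub> n)"
  by (induction n) (auto simp: nat_pow_def)

text \<open>Multiplication and inversion are componentwise, so witnesses for the two projections of
  \<open>S\<close> pair up to a witness for \<open>S\<close>.\<close>

lemma commuting_conjugates_DirProd:
  assumes "group G" "group H" "commuting_conjugates G" "commuting_conjugates H"
  shows "commuting_conjugates (G \<times>\<times> H)"
proof -
  interpret G: group G by fact
  interpret H: group H by fact
  interpret GH: group "G \<times>\<times> H"
    by (simp add: DirProd_group assms(1,2))
  show ?thesis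
    unfolding GH.commuting_conjugates_iff
  proof (intro allI impI, elim conjE)
    fix S assume S: "finite S" "S \<subseteq> carrier (G \<times>\<times> H)"
    have "finite (fst ` S)" "fst ` S \<subseteq> carrier G" "finite (snd ` S)" "snd ` S \<subseteq> carrier H"
      using S by auto
    then obtain t u where t: "t \<in> carrier G" "\<And>h k. h \<in> fst ` S \<Longrightarrow> k \<in> fst ` S \<Longrightarrow>
        h \<otimes>\<^bsub>G\<^esub> (t \<otimes>\<^bsub>G\<^esub> k \<otimes>\<^bsub>G\<^esub> inv\<^bsub>G\<^esub> t) = t \<otimes>\<^bsub>G\<^esub> k \<otimes>\<^bsub>G\<^esub> inv\<^bsub>G\<^esub> t \<otimes>\<^bsub>G\<^esub> h"
      and u: "u \<in> carrier H" "\<And>h k. h \<in> snd ` S \<Longrightarrow> k \<in> snd ` S \<Longrightarrow>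
        h \<otimes>\<^bsub>H\<^esub> (u \<otimes>\<^bsub>H\<^esub> k \<otimes>\<^bsub>H\<^esub> inv\<^bsub>H\<^esub> u) = u \<otimes>\<^bsub>H\<^esub> k \<otimes>\<^bsub>H\<^esub> inv\<^bsub>H\<^esub> u \<otimes>\<^bsub>H\<^esub> h"
      using assms(3,4) unfolding G.commuting_conjugates_iff H.commuting_conjugates_iff
      by meson
    have inv: "inv\<^bsub>G \<times>\<times> H\<^esub> (t, u) = (inv\<^bsub>G\<^esub> t, inv\<^bsub>H\<^esub> u)"
      using inv_DirProd[OF assms(1,2) t(1) u(1)] .
    show "\<exists>t\<in>carrier (G \<times>\<times> H). \<forall>h\<in>S. \<forall>k\<in>S.
        h \<otimes>\<^bsub>G \<times>\<times> H\<^esub> (t \<otimes>\<^bsub>G \<times>\<times> H\<^esub> k \<otimes>\<^bsub>G \<times>\<times> H\<^esub> inv\<^bsub>G \<times>\<times> H\<^esub> t) =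
        t \<otimes>\<^bsub>G \<times>\<times> H\<^esub> k \<otimes>\<^bsub>G \<times>\<times> H\<^esub> inv\<^bsub>G \<times>\<times> H\<^esub> t \<otimes>\<^bsub>G \<times>\<times> H\<^esub> h"
    proof (intro bexI[of _ "(t, u)"] ballI)
      fix h k assume "h \<in> S" "k \<in> S"
      then show "h \<otimes>\<^bsub>G \<times>\<times> H\<^esub> ((t, u) \<otimes>\<^bsub>G \<times>\<times> H\<^esub> k \<otimes>\<^bsub>G \<times>\<times> H\<^esub> inv\<^bsub>G \<times>\<times> H\<^esub> (t, u)) =
          (t, u) \<otimes>\<^bsub>G \<times>\<times> H\<^esub> k \<otimes>\<^bsub>G \<times>\<times> H\<^esub> inv\<^bsub>G \<times>\<times> H\<^esub> (t, u) \<otimes>\<^bsub>G \<times>\<times> H\<^esub> h"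
        unfolding inv mult_DirProd' using t(2) u(2) by simp
    qed (use t(1) u(1) in simp)
  qed
qed

section \<open>Compactly supported homeomorphisms of the line\<close>

interpretation homeo_c: group homeo_c
  by (rule group_homeo_c)

lemma homeo_c_mult: "f \<otimes>\<^bsub>homeo_c\<^esub> g = f \<circ> g"
  by (simp add: homeo_c_def)

lemma homeo_c_one: "\<one>\<^bsub>homeo_c\<^esub> = id"
  by (simp add: homeo_c_def)

lemma homeo_c_inv_apply:
  assumes "t \<in> carrier homeo_c"
  shows "t ((inv\<^bsub>homeo_c\<^esub> t) x) = x" "(inv\<^bsub>homeo_c\<^esub> t) (t x) = x"
  using homeo_c.r_inv[OF assms] homeo_c.l_inv[OF assms]
  by (simp_all add: homeo_c_mult homeo_c_one fun_eq_iff)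

lemma homeo_c_bij:
  assumes "f \<in> carrier homeo_c"
  shows "bij f"
  using homeo_c_inv_apply[OF assms] by (intro o_bij[of "inv\<^bsub>homeo_c\<^esub> f"]) auto

lemma homeo_c_bounded_support:
  assumes "f \<in> carrier homeo_c"
  obtains a where "a > 0" "\<And>x. a < \<bar>x\<bar> \<Longrightarrow> f x = x"
proof -
  have "bounded (closure {x. f x \<noteq> x})"
    using assms compact_imp_bounded by (auto simp: homeo_c_def)
  then have "bounded {x. f x \<noteq> x}"
    by (meson bounded_subset closure_subset)
  then obtain a where "a > 0" "\<forall>x\<in>{x. f x \<noteq> x}. norm x \<le> a"
    unfolding bounded_pos by blast
  then show ?thesis
    by (intro that[of a]) force+
qed

text \<open>A continuous injection on an interval is strictly monotone, and being the identity far
  out in both directions excludes the decreasing case.\<close>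

lemma homeo_c_strict_mono:
  assumes f: "f \<in> carrier homeo_c"
  shows "strict_mono f"
proof -
  obtain a where a: "a > 0" "\<And>x. a < \<bar>x\<bar> \<Longrightarrow> f x = x"
    using homeo_c_bounded_support[OF f] by metis
  have cont: "continuous_on A f" for A
    using f by (auto simp: homeo_c_def homeomorphism_def intro: continuous_on_subset)
  have inj: "inj f"
    using homeo_c_bij[OF f] by (rule bij_is_inj)
  show ?thesis
  proof (rule strict_monoI)
    fix x y :: real assume "x < y"
    \<comment> \<open>Large enough that \<open>-b\<close> and \<open>b\<close> lie outside the
      support and \<open>x\<close>, \<open>y\<close> lie strictly between them.\<close>
    define b where "b = a + \<bar>x\<bar> + \<bar>y\<bar> + 1"
    have b: "f (-b) = -b" "f b = b" "-b < x" "y < b"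
      using a(1) by (auto simp: b_def intro!: a(2))
    have "f (-b) < f x" "f x < f b"
      using continuous_inj_imp_mono[of "-b" x b f] cont b \<open>x < y\<close> inj_on_subset[OF inj]
      by force+
    \<comment> \<open>The second alternative puts \<open>f b\<close> below \<open>f x\<close>,
      contrary to the previous bounds.\<close>
    moreover have "f x < f y \<and> f y < f b \<or> f b < f y \<and> f y < f x"
      using continuous_inj_imp_mono[of x y b f] cont b \<open>x < y\<close> inj_on_subset[OF inj]
      by force
    ultimately show "f x < f y"
      by linarith
  qed
qed

text \<open>If \<open>t\<close> moves 0 to one side, monotonicity keeps all later iterates of 0
  strictly on that side, so none returns to 0.\<close>

lemma homeo_c_pow_fixes_zero:
  assumes t: "t \<in> carrier homeo_c" and "(t [^]\<^bsub>homeo_c\<^esub> n) 0 = 0" "(n::nat) > 0"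
  shows "t 0 = 0"
proof (rule ccontr)
  have mono: "t x < t y \<longleftrightarrow> x < y" for x y
    using homeo_c_strict_mono[OF t] by (rule strict_mono_less)
  \<comment> \<open>Powers are defined with the new factor on the right; with \<open>t\<close>
    outermost, its monotonicity applies to the previous iterate.\<close>
  have pow_Suc: "(t [^]\<^bsub>homeo_c\<^esub> Suc m) x = t ((t [^]\<^bsub>homeo_c\<^esub> m) x)" for m x
    using homeo_c.nat_pow_Suc2[OF t] by (simp add: homeo_c_mult)
  obtain m where m: "n = Suc m"
    using \<open>n > 0\<close> gr0_implies_Suc by blast
  assume "t 0 \<noteq> 0"
  then consider "t 0 > 0" | "t 0 < 0"
    by linarith
  then show False
  proof cases
    case 1
    \<comment> \<open>The induction starts at exponent 1, because the zeroth power fixes 0.\<close>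
    have "(t [^]\<^bsub>homeo_c\<^esub> Suc k) 0 > 0" for k
    proof (induction k)
      case 0
      show ?case
        unfolding pow_Suc by (simp add: homeo_c_one 1)
    next
      case (Suc k)
      then have "t ((t [^]\<^bsub>homeo_c\<^esub> Suc k) 0) > t 0"
        unfolding mono .
      then show ?case
        unfolding pow_Suc[of "Suc k"] using 1 by (rule less_trans[rotated])
    qed
    then have "(t [^]\<^bsub>homeo_c\<^esub> n) 0 > 0"
      unfolding m .
    then show False
      using assms(2) by simp
  next
    case 2
    have "(t [^]\<^bsub>homeo_c\<^esub> Suc k) 0 < 0" for k
    proof (induction k)
      case 0
      show ?case
        unfolding pow_Suc by (simp add: homeo_c_one 2)
    next
      case (Suc k)
      then have "t ((t [^]\<^bsub>homeo_c\<^esub> Suc k) 0) < t 0"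
        unfolding mono .
      then show ?case
        unfolding pow_Suc[of "Suc k"] using 2 by (rule less_trans)
    qed
    then have "(t [^]\<^bsub>homeo_c\<^esub> n) 0 < 0"
      unfolding m .
    then show False
      using assms(2) by simp
  qed
qed

section \<open>Bump homeomorphisms\<close>

text \<open>For \<open>x\<close> between \<open>c\<close> and \<open>d\<close> both linear functions in the minimum exceed \<open>x\<close>;
  outside of that interval one of them is at most \<open>x\<close>.\<close>

definition bump :: "real \<Rightarrow> real \<Rightarrow> real \<Rightarrow> real" where
  "bump c d x = max x (min (2 * x - c) ((x + d) / 2))"

lemma bump_neq_iff: "bump c d x \<noteq> x \<longleftrightarrow> c < x \<and> x < d"
  by (auto simp: bump_def min_def max_def)

lemma bump_in_homeo_c: "bump c d \<in> carrier homeo_c"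
proof -
  \<comment> \<open>The inverse of \<open>bump c d\<close>: each increasing linear piece is
    inverted, and passing to inverses exchanges minimum and maximum.\<close>
  define g where "g y = min y (max ((y + c) / 2) (2 * y - d))" for y
  have "homeomorphism UNIV UNIV (bump c d) g"
  proof (rule homeomorphismI)
    show "continuous_on UNIV (bump c d)" "continuous_on UNIV g"
      unfolding bump_def g_def by (intro continuous_intros; simp)+
    show "g (bump c d x) = x" "bump c d (g x) = x" for x
      unfolding bump_def g_def min_def max_def by (auto simp: field_simps)
  qed auto
  moreover have "{x. bump c d x \<noteq> x} = {c<..<d}"
    by (auto simp: bump_neq_iff)
  then have "compact (closure {x. bump c d x \<noteq> x})"
    by simp
  ultimately show ?thesis
    by (auto simp: homeo_c_def)
qed

text \<open>Commuting with \<open>bump 0 1\<close> makes \<open>u\<close> preserve its set of moved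
  points, the open interval from 0 to 1; an increasing bijection doing so fixes the left
  endpoint.\<close>

lemma fixes_zero_if_commutes_bump:
  assumes u: "u \<in> carrier homeo_c"
    and comm: "bump 0 1 \<otimes>\<^bsub>homeo_c\<^esub> u = u \<otimes>\<^bsub>homeo_c\<^esub> bump 0 1"
  shows "u 0 = 0"
proof -
  have mono: "u x < u y \<longleftrightarrow> x < y" for x y
    using homeo_c_strict_mono[OF u] by (rule strict_mono_less)
  have "bump 0 1 (u x) = u (bump 0 1 x)" for x
    using comm by (simp add: homeo_c_mult fun_eq_iff)
  then have supp: "0 < u x \<and> u x < 1 \<longleftrightarrow> 0 < x \<and> x < 1" for x
    by (metis bump_neq_iff homeo_c_bij[OF u] bij_is_inj inj_eq)
  obtain y where y: "u y = 0"
    using homeo_c_inv_apply[OF u] by blast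
  show ?thesis
    \<comment> \<open>Comparison with the sample point 1/2 gives \<open>u 0 \<le> 0\<close> and
      \<open>y \<le> 0\<close>. If \<open>y < 0\<close>, then \<open>0 = u y < u 0\<close>, which is
      impossible; hence \<open>y = 0\<close>.\<close>
    using supp[of 0] supp[of "1/2"] supp[of y] y mono[of 0 "1/2"] mono[of "1/2" y] mono[of y 0]
      mono[of 0 y] by auto
qed

section \<open>Displacing a bounded support\<close>

text \<open>All of \<open>S\<close> is supported between \<open>-a\<close> and \<open>a\<close>. A
  \<open>t\<close> pushing that interval to the right of \<open>a\<close> makes the supports of
  \<open>h\<close> and of the conjugate of \<open>k\<close> disjoint, and homeomorphisms with
  disjoint supports commute.\<close>

lemma commuting_conjugates_homeo_c: "commuting_conjugates homeo_c"
  unfolding homeo_c.commuting_conjugates_iff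
proof (intro allI impI, elim conjE)
  fix S assume S: "finite S" "S \<subseteq> carrier homeo_c"
  have "\<exists>a>0. \<forall>f\<in>S. \<forall>x. a < \<bar>x\<bar> \<longrightarrow> f x = x"
    using S
  proof (induction rule: finite_induct)
    case empty
    show ?case by (auto intro: exI[of _ 1])
  next
    case (insert f F)
    then obtain a b where "a > 0" "\<forall>f\<in>F. \<forall>x. a < \<bar>x\<bar> \<longrightarrow> f x = x" "\<And>x. b < \<bar>x\<bar> \<Longrightarrow> f x = x"
      using homeo_c_bounded_support[of f] by (metis insert_subset)
    then show ?case
      by (intro exI[of _ "max a b"]) auto
  qed
  then obtain a where a: "a > 0" "\<And>f x. f \<in> S \<Longrightarrow> a < \<bar>x\<bar> \<Longrightarrow> f x = x"
    by blast
  \<comment> \<open>With these endpoints the two linear functions in \<open>bump\<close> take the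
    values \<open>a + 1\<close> and \<open>a + 1/2\<close> at \<open>-a\<close>, both above
    \<open>a\<close>.\<close>
  define t where "t = bump (- 3 * a - 1) (3 * a + 1)"
  have t: "t \<in> carrier homeo_c"
    by (simp add: t_def bump_in_homeo_c)
  have displace: "a < t x" if "- a \<le> x" for x
    using that a(1) by (auto simp: t_def bump_def min_def max_def)
  have "h \<circ> (t \<circ> k \<circ> inv\<^bsub>homeo_c\<^esub> t) = t \<circ> k \<circ> inv\<^bsub>homeo_c\<^esub> t \<circ> h"
    if hk: "h \<in> S" "k \<in> S" for h k
  proof
    fix x
    let ?u = "t \<circ> k \<circ> inv\<^bsub>homeo_c\<^esub> t"
    have u_fix: "?u y = y" if "y \<le> a" for y
    proof -
      have "(inv\<^bsub>homeo_c\<^esub> t) y < - a"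
        using displace[of "(inv\<^bsub>homeo_c\<^esub> t) y"] that homeo_c_inv_apply(1)[OF t, of y] by linarith
      then have "k ((inv\<^bsub>homeo_c\<^esub> t) y) = (inv\<^bsub>homeo_c\<^esub> t) y"
        using a(1) by (intro a(2)[OF hk(2)]) auto
      then show ?thesis
        by (simp add: homeo_c_inv_apply(1)[OF t])
    qed
    have h: "h y = y" if "a < y" for y
      using that a(1) by (intro a(2)[OF hk(1)]) auto
    have "h \<in> carrier homeo_c" "?u \<in> carrier homeo_c"
      using S(2) hk t homeo_c.m_closed homeo_c.inv_closed
      by (auto simp flip: homeo_c_mult)
    then have mono: "strict_mono h" "strict_mono ?u"
      by (auto intro: homeo_c_strict_mono)
    show "(h \<circ> ?u) x = (?u \<circ> h) x"
    proof (cases "x \<le> a")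
      case True
      \<comment> \<open>Otherwise \<open>h\<close> fixes \<open>h x\<close>, and injectivity gives
        \<open>h x = x \<le> a\<close>. The other case treats \<open>?u\<close> in the same
        way.\<close>
      then have "h x \<le> a"
        using h[of "h x"] strict_mono_eq[OF mono(1)] by (metis linorder_not_le)
      with True show ?thesis
        using u_fix by simp
    next
      case False
      then have "a < ?u x"
        using u_fix[of "?u x"] strict_mono_eq[OF mono(2)] by (metis linorder_not_le)
      with False show ?thesis
        using h by simp
    qed
  qed
  then show "\<exists>t\<in>carrier homeo_c. \<forall>h\<in>S. \<forall>k\<in>S.
      h \<otimes>\<^bsub>homeo_c\<^esub> (t \<otimes>\<^bsub>homeo_c\<^esub> k \<otimes>\<^bsub>homeo_c\<^esub> inv\<^bsub>homeo_c\<^esub> t) =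
      t \<otimes>\<^bsub>homeo_c\<^esub> k \<otimes>\<^bsub>homeo_c\<^esub> inv\<^bsub>homeo_c\<^esub> t \<otimes>\<^bsub>homeo_c\<^esub> h"
    using t unfolding homeo_c_mult by blast
qed

section \<open>Excluding cyclic conjugates\<close>

text \<open>The point 0 is an endpoint of the support of \<open>bump 0 1\<close> but is moved by
  \<open>bump (-1) 1\<close>. Commutation with the former makes both \<open>t\<close> and the
  conjugate of the latter fix 0, which is contradictory.\<close>

lemma not_finite_cyclic_commuting_bumps:
  assumes t: "t \<in> carrier homeo_c" and "(n::nat) > 0"
    and pow: "bump 0 1 \<otimes>\<^bsub>homeo_c\<^esub> t [^]\<^bsub>homeo_c\<^esub> n = t [^]\<^bsub>homeo_c\<^esub> n \<otimes>\<^bsub>homeo_c\<^esub> bump 0 1"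
  shows "bump 0 1 \<otimes>\<^bsub>homeo_c\<^esub> (t \<otimes>\<^bsub>homeo_c\<^esub> bump (-1) 1 \<otimes>\<^bsub>homeo_c\<^esub> inv\<^bsub>homeo_c\<^esub> t) \<noteq>
    t \<otimes>\<^bsub>homeo_c\<^esub> bump (-1) 1 \<otimes>\<^bsub>homeo_c\<^esub> inv\<^bsub>homeo_c\<^esub> t \<otimes>\<^bsub>homeo_c\<^esub> bump 0 1"
proof
  let ?u = "t \<otimes>\<^bsub>homeo_c\<^esub> bump (-1) 1 \<otimes>\<^bsub>homeo_c\<^esub> inv\<^bsub>homeo_c\<^esub> t"
  assume "bump 0 1 \<otimes>\<^bsub>homeo_c\<^esub> ?u = ?u \<otimes>\<^bsub>homeo_c\<^esub> bump 0 1"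
  then have u: "?u 0 = 0"
    using t bump_in_homeo_c by (intro fixes_zero_if_commutes_bump) auto
  have t0: "t 0 = 0"
    using homeo_c_pow_fixes_zero[OF t _ \<open>n > 0\<close>] fixes_zero_if_commutes_bump[OF _ pow] t by simp
  then have "(inv\<^bsub>homeo_c\<^esub> t) 0 = 0"
    using homeo_c_inv_apply(2)[OF t, of 0] by simp
  then have "t (bump (-1) 1 0) = t 0"
    using u t0 by (simp add: homeo_c_mult)
  then have "bump (-1) 1 0 = 0"
    using homeo_c_bij[OF t] by (meson bij_is_inj inj_eq)
  then show False
    using bump_neq_iff[of "-1" 1 0] by simp
qed

theorem proposition3p6:
  fixes \<Gamma>\<^sub>2 :: "('a, 'b) monoid_scheme"
  assumes "group \<Gamma>\<^sub>2"
    and "commuting_conjugates \<Gamma>\<^sub>2"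
    and "\<not> commuting_Z_conjugates \<Gamma>\<^sub>2"
  shows "commuting_conjugates (homeo_c \<times>\<times> \<Gamma>\<^sub>2) \<and>
    \<not> commuting_cyclic_conjugates (homeo_c \<times>\<times> \<Gamma>\<^sub>2)"
proof
  let ?P = "homeo_c \<times>\<times> \<Gamma>\<^sub>2"
  interpret group \<Gamma>\<^sub>2 by fact
  interpret P: group ?P
    by (simp add: DirProd_group group_homeo_c assms(1))
  show "commuting_conjugates ?P"
    using commuting_conjugates_DirProd group_homeo_c commuting_conjugates_homeo_c assms(1,2)
    by blast
  show "\<not> commuting_cyclic_conjugates ?P"
  proof
    assume cyclic: "commuting_cyclic_conjugates ?P"
    obtain T where T: "finite T" "T \<subseteq> carrier \<Gamma>\<^sub>2"
      and noZ: "\<not> (\<exists>t\<in>carrier \<Gamma>\<^sub>2. \<forall>p::nat. p \<ge> 1 \<longrightarrow> (\<forall>h\<in>T. \<forall>k\<in>T.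
        h \<otimes>\<^bsub>\<Gamma>\<^sub>2\<^esub> (t [^]\<^bsub>\<Gamma>\<^sub>2\<^esub> p \<otimes>\<^bsub>\<Gamma>\<^sub>2\<^esub> k \<otimes>\<^bsub>\<Gamma>\<^sub>2\<^esub> inv\<^bsub>\<Gamma>\<^sub>2\<^esub> (t [^]\<^bsub>\<Gamma>\<^sub>2\<^esub> p)) =
        t [^]\<^bsub>\<Gamma>\<^sub>2\<^esub> p \<otimes>\<^bsub>\<Gamma>\<^sub>2\<^esub> k \<otimes>\<^bsub>\<Gamma>\<^sub>2\<^esub> inv\<^bsub>\<Gamma>\<^sub>2\<^esub> (t [^]\<^bsub>\<Gamma>\<^sub>2\<^esub> p) \<otimes>\<^bsub>\<Gamma>\<^sub>2\<^esub> h))"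
      using assms(3) unfolding commuting_Z_conjugates_iff by blast
    \<comment> \<open>Padding with identities lets each commutation in the product be read off in a
      single factor: the bumps test the first coordinate, \<open>T\<close> the second.\<close>
    define S where "S = {(bump 0 1, \<one>\<^bsub>\<Gamma>\<^sub>2\<^esub>), (bump (-1) 1, \<one>\<^bsub>\<Gamma>\<^sub>2\<^esub>)} \<union> Pair \<one>\<^bsub>homeo_c\<^esub> ` T"
    have S: "finite S" "S \<subseteq> carrier ?P"
      using T bump_in_homeo_c homeo_c.one_closed by (auto simp: S_def)
    obtain z n where z: "z \<in> carrier ?P" and n: "n \<ge> 2"
      and zp: "\<And>p h k. 1 \<le> p \<Longrightarrow> enat p < n \<Longrightarrow> h \<in> S \<Longrightarrow> k \<in> S \<Longrightarrow>
        h \<otimes>\<^bsub>?P\<^esub> (z [^]\<^bsub>?P\<^esub> p \<otimes>\<^bsub>?P\<^esub> k \<otimes>\<^bsub>?P\<^esub> inv\<^bsub>?P\<^esub> (z [^]\<^bsub>?P\<^esub> p)) =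
        z [^]\<^bsub>?P\<^esub> p \<otimes>\<^bsub>?P\<^esub> k \<otimes>\<^bsub>?P\<^esub> inv\<^bsub>?P\<^esub> (z [^]\<^bsub>?P\<^esub> p) \<otimes>\<^bsub>?P\<^esub> h"
      and zn: "\<And>h. h \<in> S \<Longrightarrow> h \<otimes>\<^bsub>?P\<^esub> enat_pow ?P z n = enat_pow ?P z n \<otimes>\<^bsub>?P\<^esub> h"
      by (fact P.commuting_cyclic_conjugatesD[OF cyclic S])
    obtain t u where tu: "z = (t, u)" "t \<in> carrier homeo_c" "u \<in> carrier \<Gamma>\<^sub>2"
      using z by auto
    have inv_pow: "inv\<^bsub>?P\<^esub> (z [^]\<^bsub>?P\<^esub> p) = (inv\<^bsub>homeo_c\<^esub> (t [^]\<^bsub>homeo_c\<^esub> p), inv\<^bsub>\<Gamma>\<^sub>2\<^esub> (u [^]\<^bsub>\<Gamma>\<^sub>2\<^esub> p))"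
      for p :: nat
      using tu by (simp add: pow_DirProd inv_DirProd group_homeo_c assms(1))
    show False
    proof (cases n)
      case (enat m)
      \<comment> \<open>The bound \<open>n \<ge> 2\<close> is what makes the exponent
        \<open>p = 1\<close> admissible.\<close>
      have "m > 0" "enat 1 < n"
        using n by (auto simp: enat numeral_eq_enat)
      moreover have "bump 0 1 \<otimes>\<^bsub>homeo_c\<^esub> t [^]\<^bsub>homeo_c\<^esub> m = t [^]\<^bsub>homeo_c\<^esub> m \<otimes>\<^bsub>homeo_c\<^esub> bump 0 1"
        using zn[of "(bump 0 1, \<one>\<^bsub>\<Gamma>\<^sub>2\<^esub>)"] by (simp add: S_def enat tu(1) pow_DirProd)
      ultimately show False
        using not_finite_cyclic_commuting_bumps[OF tu(2), of m]
          zp[of 1 "(bump 0 1, \<one>\<^bsub>\<Gamma>\<^sub>2\<^esub>)" "(bump (-1) 1, \<one>\<^bsub>\<Gamma>\<^sub>2\<^esub>)"] tu(2)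
        unfolding inv_pow by (simp add: S_def tu(1) pow_DirProd)
    next
      case infinity
      \<comment> \<open>Now every \<open>p \<ge> 1\<close> is below \<open>n\<close>, so
        \<open>u\<close> would be a witness of commuting \<int>-conjugates for
        \<open>T\<close>.\<close>
      have "h \<otimes>\<^bsub>\<Gamma>\<^sub>2\<^esub> (u [^]\<^bsub>\<Gamma>\<^sub>2\<^esub> p \<otimes>\<^bsub>\<Gamma>\<^sub>2\<^esub> k \<otimes>\<^bsub>\<Gamma>\<^sub>2\<^esub> inv\<^bsub>\<Gamma>\<^sub>2\<^esub> (u [^]\<^bsub>\<Gamma>\<^sub>2\<^esub> p)) =
          u [^]\<^bsub>\<Gamma>\<^sub>2\<^esub> p \<otimes>\<^bsub>\<Gamma>\<^sub>2\<^esub> k \<otimes>\<^bsub>\<Gamma>\<^sub>2\<^esub> inv\<^bsub>\<Gamma>\<^sub>2\<^esub> (u [^]\<^bsub>\<Gamma>\<^sub>2\<^esub> p) \<otimes>\<^bsub>\<Gamma>\<^sub>2\<^esub> h"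
        if "p \<ge> 1" "h \<in> T" "k \<in> T" for p :: nat and h k
        using zp[of p "(\<one>\<^bsub>homeo_c\<^esub>, h)" "(\<one>\<^bsub>homeo_c\<^esub>, k)"] that
        unfolding inv_pow by (simp add: S_def infinity tu(1) pow_DirProd)
      then show False
        using noZ tu(3) by blast
    qed
  qed
qed

end
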